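(* Every convex-like structure is affinely and isometrically isomorphic to a closed convex subset of a Banach space. That is: let $(X,d)$ be a complete metric space with a convex-like structure $\{\gamma_\mu\}$. Then there exist a real Banach space $B$, a closed convex subset $C\subseteq B$ and a bijection $\varphi\colon X\to C$ such that $\|\varphi(x)-\varphi(y)\|=d(x,y)$ for all $x,y\in X$, and $\varphi(\gamma_\mu(x_1,\ldots,x_n))=\sum_{i=1}^n\mu(i)\varphi(x_i)$ for all $n\ge 1$, $\mu\in\mathrm{Prob}_n$ and $x_1,\ldots,x_n\in X$.
   Context: For $n\ge 1$, $\mathrm{Prob}_n$ denotes the set of probability measures on $\{1,\ldots,n\}$, endowed with the $\ell_1$-metric, and $X^{(n)}$ is the $n$-fold Cartesian product of $X$. A complete metric space $(X,d)$ has a convex-like structure if for every $n\ge 1$ and $\mu\in\mathrm{Prob}_n$ there is given a continuous map $\gamma_\mu\colon X^{(n)}\to X$ such that: (1) for each permutation $\sigma\in S_n$ and $x_1,\ldots,x_n\in X$, $\gamma_\mu(x_1,\ldots,x_n)=\gamma_{\mu\circ\sigma}(x_{\sigma(1)},\ldots,x_{\sigma(n)})$; (2) if $n\geq 2$ and $x_1=x_2$, then $\gamma_\mu(x_1,x_2,\ldots,x_n)=\gamma_{\tilde\mu}(x_1,x_3,\ldots,x_n)$, where $\tilde\mu\in\mathrm{Prob}_{n-1}$ is given by $\tilde\mu(1)=\mu(1)+\mu(2)$ and $\tilde\mu(j)=\mu(j+1)$ for $2\le j\le n-1$; (3) if $\mu(i)=1$, then $\gamma_\mu(x_1,\ldots,x_n)=x_i$;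 (4) for all $x_1,\ldots,x_n,y_1,\ldots,y_n\in X$, $d(\gamma_\mu(x_1,\ldots,x_n),\gamma_\mu(y_1,\ldots,y_n))\le\sum_{i=1}^n\mu(i)d(x_i,y_i)$; (5) for all $\nu\in\mathrm{Prob}_2$, $\mu\in\mathrm{Prob}_n$, $\tilde\mu\in\mathrm{Prob}_m$ and $x_1,\ldots,x_n,\tilde x_1,\ldots,\tilde x_m\in X$, $\gamma_\nu(\gamma_\mu(x_1,\ldots,x_n),\gamma_{\tilde\mu}(\tilde x_1,\ldots,\tilde x_m))=\gamma_\eta(x_1,\ldots,x_n,\tilde x_1,\ldots,\tilde x_m)$, where $\eta\in\mathrm{Prob}_{n+m}$ is given by $\eta(i)=\nu(1)\mu(i)$ for $1\le i\le n$ and $\eta(n+j)=\nu(2)\tilde\mu(j)$ for $1\le j\le m$. *)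

theory Defs
  imports "HOL-Analysis.Analysis" "HOL-Library.Function_Algebras"
begin

text \<open>
  A probability measure on \<open>{1..n}\<close> is given by its point masses. Both these weights and the
  \<open>n\<close>-tuples below, elements of \<open>PiE {1..n} (\<lambda>_. X)\<close>, are extensional functions on \<open>{1..n}\<close>, so
  that each measure and each tuple has exactly one representative.
\<close>

definition Prob :: "nat \<Rightarrow> (nat \<Rightarrow> real) set" where
  "Prob n = {\<mu> \<in> extensional {1..n}. (\<forall>i\<in>{1..n}. 0 \<le> \<mu> i) \<and> (\<Sum>i=1..n. \<mu> i) = 1}"

text \<open>
  The map written \<open>\<gamma> n \<mu>\<close> is \<open>\<gamma>\<^sub>\<mu>\<close> for \<open>\<mu> \<in> Prob n\<close>. In \<open>perm\<close> no restriction is needed: a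
  function permuting \<open>{1..n}\<close> is the identity elsewhere, so \<open>\<mu> \<circ> \<sigma>\<close> and \<open>x \<circ> \<sigma>\<close> are extensional.
\<close>

locale convex_like_structure = Metric_space X d
  for X :: "'a set" and d :: "'a \<Rightarrow> 'a \<Rightarrow> real" +
  fixes \<gamma> :: "nat \<Rightarrow> (nat \<Rightarrow> real) \<Rightarrow> (nat \<Rightarrow> 'a) \<Rightarrow> 'a"
  assumes complete: "mcomplete"
    and continuous:
      "\<And>n \<mu>. \<lbrakk>n \<ge> 1; \<mu> \<in> Prob n\<rbrakk> \<Longrightarrow>
        continuous_map (product_topology (\<lambda>_. mtopology) {1..n}) mtopology (\<gamma> n \<mu>)"
    and perm:
      "\<And>n \<mu> \<sigma> x. \<lbrakk>n \<ge> 1; \<mu> \<in> Prob n; \<sigma> permutes {1..n}; x \<in> {1..n} \<rightarrow>\<^sub>E X\<rbrakk> \<Longrightarrow>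
        \<gamma> n \<mu> x = \<gamma> n (\<mu> \<circ> \<sigma>) (x \<circ> \<sigma>)"
    and merge:
      "\<And>n \<mu> x. \<lbrakk>n \<ge> 2; \<mu> \<in> Prob n; x \<in> {1..n} \<rightarrow>\<^sub>E X; x 1 = x 2\<rbrakk> \<Longrightarrow>
        \<gamma> n \<mu> x = \<gamma> (n - 1)
          (\<lambda>j\<in>{1..n - 1}. if j = 1 then \<mu> 1 + \<mu> 2 else \<mu> (j + 1))
          (\<lambda>j\<in>{1..n - 1}. if j = 1 then x 1 else x (j + 1))"
    and dirac:
      "\<And>n \<mu> x i. \<lbrakk>n \<ge> 1; \<mu> \<in> Prob n; x \<in> {1..n} \<rightarrow>\<^sub>E X; i \<in> {1..n}; \<mu> i = 1\<rbrakk> \<Longrightarrow>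
        \<gamma> n \<mu> x = x i"
    and dist_le:
      "\<And>n \<mu> x y. \<lbrakk>n \<ge> 1; \<mu> \<in> Prob n; x \<in> {1..n} \<rightarrow>\<^sub>E X; y \<in> {1..n} \<rightarrow>\<^sub>E X\<rbrakk> \<Longrightarrow>
        d (\<gamma> n \<mu> x) (\<gamma> n \<mu> y) \<le> (\<Sum>i=1..n. \<mu> i * d (x i) (y i))"
    and compose:
      "\<And>n m \<nu> \<mu> \<mu>' x x'. \<lbrakk>n \<ge> 1; m \<ge> 1; \<nu> \<in> Prob 2; \<mu> \<in> Prob n; \<mu>' \<in> Prob m;
          x \<in> {1..n} \<rightarrow>\<^sub>E X; x' \<in> {1..m} \<rightarrow>\<^sub>E X\<rbrakk> \<Longrightarrow>
        \<gamma> 2 \<nu> (\<lambda>k\<in>{1..2}. if k = 1 then \<gamma> n \<mu> x else \<gamma> m \<mu>' x') =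
        \<gamma> (n + m)
          (\<lambda>k\<in>{1..n + m}. if k \<le> n then \<nu> 1 * \<mu> k else \<nu> 2 * \<mu>' (k - n))
          (\<lambda>k\<in>{1..n + m}. if k \<le> n then x k else x' (k - n))"

text \<open>
  Since HOL cannot quantify existentially over types, a Banach space is presented as a linear
  subspace \<open>B\<close> of an ambient real vector space, carrying its own complete norm \<open>N\<close>. The ambient
  space only provides the linear operations; any topology or norm it may have is irrelevant. As
  for the distance function in \<open>Metric_space\<close>, nonnegativity (and homogeneity) of \<open>N\<close> are also
  asked for outside the carrier, which is harmless since \<open>N\<close> can be taken to be \<open>0\<close> there.
\<close>

abbreviation (input) norm_dist :: "('v::real_vector \<Rightarrow> real) \<Rightarrow> 'v \<Rightarrow> 'v \<Rightarrow> real" where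
  "norm_dist N \<equiv> \<lambda>u v. N (u - v)"

definition banach_on :: "'v::real_vector set \<Rightarrow> ('v \<Rightarrow> real) \<Rightarrow> bool" where
  "banach_on B N \<longleftrightarrow>
     subspace B \<and>
     (\<forall>v. 0 \<le> N v) \<and>
     (\<forall>v\<in>B. N v = 0 \<longrightarrow> v = 0) \<and>
     (\<forall>c v. N (c *\<^sub>R v) = \<bar>c\<bar> * N v) \<and>
     (\<forall>u\<in>B. \<forall>v\<in>B. N (u + v) \<le> N u + N v) \<and>
     Metric_space.mcomplete B (norm_dist N)"

lemma banach_on_Metric_space:
  assumes "banach_on B N"
  shows "Metric_space B (norm_dist N)"
proof
  from assms have subspace: "subspace B"
    and nonneg: "\<And>v. 0 \<le> N v"
    and definite: "\<And>v. v \<in> B \<Longrightarrow> N v = 0 \<Longrightarrow> v = 0"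
    and homogeneous: "\<And>c v. N (c *\<^sub>R v) = \<bar>c\<bar> * N v"
    and triangle: "\<And>u v. u \<in> B \<Longrightarrow> v \<in> B \<Longrightarrow> N (u + v) \<le> N u + N v"
    by (simp_all only: banach_on_def)
  have diff: "u - v \<in> B" if "u \<in> B" "v \<in> B" for u v
    using subspace that by (rule subspace_diff)
  show "0 \<le> N (x - y)" for x y
    by (rule nonneg)
  show "N (x - y) = N (y - x)" for x y
    using homogeneous[of "-1" "x - y"] by simp
  show "N (x - y) = 0 \<longleftrightarrow> x = y" if "x \<in> B" "y \<in> B" for x y
    using homogeneous[of 0 0] definite[OF diff[OF that]] by auto
  show "N (x - z) \<le> N (x - y) + N (y - z)" if "x \<in> B" "y \<in> B" "z \<in> B" for x y z
    using triangle[OF diff[of x y] diff[of y z]] that by simp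
qed

lemma banach_on_UNIV: "banach_on (UNIV :: 'b::banach set) norm"
proof -
  have "norm_dist (norm :: 'b \<Rightarrow> real) = dist"
    by (intro ext) (simp only: dist_norm)
  then show ?thesis
    unfolding banach_on_def
    by (simp only: mcomplete_iff_complete complete_UNIV) (simp add: norm_triangle_ineq)
qed

text \<open>
  The pointwise operations on \<open>('a \<Rightarrow> real) \<Rightarrow> real\<close> give an ambient space which is large enough to
  hold, up to linear isomorphism, every Banach space that is the closed linear span of a subset
  of cardinality at most that of \<open>'a\<close>: such a space has at most as many elements as there are
  functions \<open>'a \<Rightarrow> real\<close>, while the ambient space has at least that dimension.
\<close>

instantiation "fun" :: (type, real_vector) real_vector
begin

definition scaleR_fun :: "real \<Rightarrow> ('a \<Rightarrow> 'b) \<Rightarrow> 'a \<Rightarrow> 'b" where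
  "scaleR_fun c f = (\<lambda>x. c *\<^sub>R f x)"

instance
  by standard (simp_all only: scaleR_fun_def plus_fun_def fun_eq_iff
      scaleR_add_right scaleR_add_left scaleR_scaleR scaleR_one simp_thms)

end

end

theory Submission
  imports Defs
begin

text \<open>
  By the axioms, \<open>\<gamma>\<close> is a well-defined barycenter map on the convex hull \<open>M\<close> of the point masses of
  \<open>X\<close>, and \<open>D a b = d (barycenter a) (barycenter b)\<close> is a jointly convex pseudometric on \<open>M\<close>. Such a
  pseudometric satisfies the cancellation law
  \<open>D (t a + (1 - t) r) (t b + (1 - t) r) = t D a b\<close>, so that \<open>s (a - b) \<mapsto> s D a b\<close> is a well-defined
  sublinear functional. The Hahn-Banach theorem then yields, for any two points of \<open>X\<close>, an affine
  function with Lipschitz constant \<open>1\<close> which attains their distance. Hence mapping \<open>x\<close> to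
  \<open>h \<mapsto> h x - h x\<^sub>0\<close>, where \<open>h\<close> ranges over all such affine functions, is an affine isometry into a
  space of bounded functions with the supremum norm; subtracting \<open>h x\<^sub>0\<close> is what makes the values
  bounded in \<open>h\<close>. The image is closed because it is complete.
\<close>

section \<open>The Hahn-Banach theorem\<close>

definition sublinear :: "('v::real_vector \<Rightarrow> real) \<Rightarrow> bool" where
  "sublinear q \<longleftrightarrow> (\<forall>u v. q (u + v) \<le> q u + q v) \<and> (\<forall>c\<ge>0. \<forall>v. q (c *\<^sub>R v) = c * q v)"

lemma sublinear_add: "sublinear q \<Longrightarrow> q (u + v) \<le> q u + q v"
  and sublinear_scale: "sublinear q \<Longrightarrow> 0 \<le> c \<Longrightarrow> q (c *\<^sub>R v) = c * q v"
  by (simp_all add: sublinear_def)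

lemma sublinear_zero: "sublinear q \<Longrightarrow> q 0 = 0"
  using sublinear_scale[of q 0 0] by simp

lemma sublinear_uminus_le: "sublinear q \<Longrightarrow> - q (- v) \<le> q v"
  using sublinear_add[of q v "- v"] by (simp add: sublinear_zero)

text \<open>The inequality for \<open>inverse c\<close> at the scaled vector is the reverse of the
  inequality for \<open>c\<close>, so one-sided homogeneity for positive factors is enough; the
  factor \<open>0\<close> is covered by \<open>zero\<close>.\<close>

lemma sublinearI:
  assumes add: "\<And>u v. q (u + v) \<le> q u + q v"
    and scale: "\<And>c v. 0 < c \<Longrightarrow> q (c *\<^sub>R v) \<le> c * q v"
    and zero: "q 0 = 0"
  shows "sublinear q"
proof -
  have "q (c *\<^sub>R v) = c * q v" if "0 \<le> c" for c v
  proof (cases "c = 0")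
    case False
    then have c: "0 < c" using that by simp
    have "q v \<le> inverse c * q (c *\<^sub>R v)"
      using scale[of "inverse c" "c *\<^sub>R v"] c by simp
    then have "c * q v \<le> q (c *\<^sub>R v)"
      using c by (simp add: field_simps)
    with scale[OF c, of v] show ?thesis by simp
  qed (simp add: zero)
  with add show ?thesis by (simp add: sublinear_def)
qed

text \<open>The largest sublinear functional below \<open>q\<close> with value at most \<open>- q u\<close> at \<open>- u\<close>.\<close>

definition tilt :: "('v::real_vector \<Rightarrow> real) \<Rightarrow> 'v \<Rightarrow> 'v \<Rightarrow> real" where
  "tilt q u v = (INF t\<in>{0..}. q (v + t *\<^sub>R u) - t * q u)"

text \<open>The bound \<open>low\<close> does not depend on \<open>t\<close>, so the infimum is
  finite. Subadditivity comes from adding the parameters \<open>t\<close> and \<open>s\<close> of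
  two competitors, homogeneity from rescaling \<open>t\<close> to \<open>c * t\<close>.\<close>

lemma
  assumes q: "sublinear q"
  shows tilt_le: "0 \<le> t \<Longrightarrow> tilt q u v \<le> q (v + t *\<^sub>R u) - t * q u"
    and sublinear_tilt: "sublinear (tilt q u)"
proof -
  have low: "- q (- v) \<le> q (v + t *\<^sub>R u) - t * q u" if "0 \<le> t" for t v
    using sublinear_add[OF q, of "v + t *\<^sub>R u" "- v"] sublinear_scale[OF q that, of u] by simp
  have bdd: "bdd_below ((\<lambda>t. q (v + t *\<^sub>R u) - t * q u) ` {0..})" for v
    by (rule bdd_belowI2[of _ "- q (- v)"]) (use low in simp)
  show le: "tilt q u v \<le> q (v + t *\<^sub>R u) - t * q u" if "0 \<le> t" for t v
    unfolding tilt_def by (rule cINF_lower[OF bdd]) (use that in simp)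
  have greatest: "a \<le> tilt q u v" if "\<And>t. 0 \<le> t \<Longrightarrow> a \<le> q (v + t *\<^sub>R u) - t * q u" for a v
    unfolding tilt_def by (rule cINF_greatest) (use that in auto)
  show "sublinear (tilt q u)"
  proof (rule sublinearI)
    fix v w
    have "tilt q u (v + w) - (q (v + t *\<^sub>R u) - t * q u) \<le> q (w + s *\<^sub>R u) - s * q u"
      if "0 \<le> t" "0 \<le> s" for s t
      using le[of "t + s" "v + w"] sublinear_add[OF q, of "v + t *\<^sub>R u" "w + s *\<^sub>R u"] that
      by (simp add: algebra_simps)
    then have "tilt q u (v + w) - (q (v + t *\<^sub>R u) - t * q u) \<le> tilt q u w" if "0 \<le> t" for t
      using that by (intro greatest) simp
    then have "tilt q u (v + w) - tilt q u w \<le> tilt q u v"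
      by (intro greatest) (simp add: algebra_simps)
    then show "tilt q u (v + w) \<le> tilt q u v + tilt q u w" by simp
  next
    fix c :: real and v assume c: "0 < c"
    have "tilt q u (c *\<^sub>R v) / c \<le> q (v + t *\<^sub>R u) - t * q u" if "0 \<le> t" for t
      using le[of "c * t" "c *\<^sub>R v"] sublinear_scale[OF q, of c "v + t *\<^sub>R u"] c that
      by (simp add: field_simps scaleR_add_right)
    then have "tilt q u (c *\<^sub>R v) / c \<le> tilt q u v" by (rule greatest)
    with c show "tilt q u (c *\<^sub>R v) \<le> c * tilt q u v" by (simp add: field_simps)
  next
    show "tilt q u 0 = 0"
      using le[of 0 0] greatest[of 0 0] by (simp add: sublinear_scale[OF q] sublinear_zero[OF q])
  qed
qed

text \<open>Zorn's lemma, where the bound of a nonempty chain is its pointwise infimum; the infimum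
  is finite because every member \<open>q\<close> satisfies
  \<open>- p (- v) \<le> q v\<close>.\<close>

lemma ex_minimal_sublinear:
  assumes p: "sublinear p"
  shows "\<exists>q. sublinear q \<and> q \<le> p \<and> (\<forall>q'. sublinear q' \<longrightarrow> q' \<le> q \<longrightarrow> q' = q)"
proof -
  \<comment> \<open>The order is reversed, so that maximal elements for \<open>?R\<close> are
    minimal functionals.\<close>
  let ?A = "{q. sublinear q \<and> q \<le> p}" and ?R = "\<lambda>f g :: 'a \<Rightarrow> real. g \<le> f"
  have "\<exists>m\<in>?A. \<forall>a\<in>?A. ?R m a \<longrightarrow> a = m"
  proof (rule predicate_Zorn)
    show "partial_order_on ?A (relation_of ?R ?A)"
      by (rule partial_order_on_relation_ofI) auto
  next
    fix C assume "C \<in> Chains (relation_of ?R ?A)"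
    then have CA: "C \<subseteq> ?A" and chain: "\<And>f g. f \<in> C \<Longrightarrow> g \<in> C \<Longrightarrow> f \<le> g \<or> g \<le> f"
      by (auto simp: Chains_def relation_of_def)
    show "\<exists>u\<in>?A. \<forall>a\<in>C. ?R a u"
    proof (cases "C = {}")
      case True
      with p show ?thesis by auto
    next
      case False
      define g where "g v = (INF q\<in>C. q v)" for v
      have bdd: "bdd_below ((\<lambda>q. q v) ` C)" for v
      proof (rule bdd_belowI2[of _ "- p (- v)"])
        fix q assume "q \<in> C"
        with CA have "sublinear q" "q \<le> p" by auto
        then show "- p (- v) \<le> q v"
          using sublinear_uminus_le[of q v] le_funD[of q p "- v"] by simp
      qed
      have le: "g v \<le> q v" if "q \<in> C" for q v
        unfolding g_def by (rule cINF_lower[OF bdd that])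
      have greatest: "a \<le> g v" if "\<And>q. q \<in> C \<Longrightarrow> a \<le> q v" for a v
        unfolding g_def by (rule cINF_greatest[OF False that])
      have "sublinear g"
      proof (rule sublinearI)
        fix v w
        \<comment> \<open>This is where the chain property enters: the smaller of \<open>q\<close>
          and \<open>r\<close> is a single member whose subadditivity serves both.\<close>
        have *: "g (v + w) - q v \<le> r w" if qr: "q \<in> C" "r \<in> C" for q r
        proof -
          obtain s where s: "s \<in> C" "s \<le> q" "s \<le> r"
            using chain[OF qr] qr by blast
          have "g (v + w) \<le> s v + s w"
            using le[OF s(1), of "v + w"] sublinear_add[of s v w] CA s(1) by auto
          with s(2,3) show ?thesis using le_funD[of s q v] le_funD[of s r w] by simp
        qed
        have "g (v + w) - q v \<le> g w" if "q \<in> C" for q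
          using * that by (intro greatest)
        then have "g (v + w) - g w \<le> g v"
          by (intro greatest) (simp add: algebra_simps)
        then show "g (v + w) \<le> g v + g w" by simp
      next
        fix c :: real and v assume c: "0 < c"
        have "g (c *\<^sub>R v) / c \<le> q v" if "q \<in> C" for q
          using le[OF that, of "c *\<^sub>R v"] sublinear_scale[of q c v] CA that c
          by (auto simp: field_simps)
        then have "g (c *\<^sub>R v) / c \<le> g v" by (rule greatest)
        with c show "g (c *\<^sub>R v) \<le> c * g v" by (simp add: field_simps)
      next
        have "q 0 = 0" if "q \<in> C" for q using CA that sublinear_zero by auto
        then have "g 0 = (INF q\<in>C. 0)" unfolding g_def by (intro INF_cong) auto
        with False show "g 0 = 0" by simp
      qed
      moreover obtain q where q: "q \<in> C" using False by blast
      moreover have "g \<le> q" using le q by (auto simp: le_fun_def)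
      moreover have "q \<le> p" using q CA by auto
      ultimately have "g \<in> ?A" by auto
      with le show ?thesis by (auto simp: le_fun_def)
    qed
  qed
  then show ?thesis by (auto dest: order_trans)
qed

text \<open>By minimality, tilting does not change \<open>q\<close>. The bound on the tilt at
  \<open>t = 1\<close> then says that \<open>q\<close> is superadditive, hence additive and
  odd.\<close>

lemma minimal_sublinear_linear:
  assumes q: "sublinear q" and min: "\<And>q'. sublinear q' \<Longrightarrow> q' \<le> q \<Longrightarrow> q' = q"
  shows "linear q"
proof -
  have "tilt q u = q" for u
  proof (rule min)
    show "tilt q u \<le> q" using tilt_le[OF q, of 0 u] by (auto simp: le_fun_def)
  qed (rule sublinear_tilt[OF q])
  then have "q v \<le> q (v + u) - q u" for u v
    using tilt_le[OF q, of 1 u v] by simp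
  then have add: "q (u + v) = q u + q v" for u v
    using sublinear_add[OF q, of u v] by (smt (verit))
  then have minus: "q (- v) = - q v" for v
    using add[of v "- v"] sublinear_zero[OF q] by simp
  have "q (c *\<^sub>R v) = c * q v" for c v
    using sublinear_scale[OF q, of c v] sublinear_scale[OF q, of "- c" v] minus[of "c *\<^sub>R v"]
    by (cases "0 \<le> c") auto
  with add show ?thesis by (intro linearI) auto
qed

text \<open>The minimal functional is taken below \<open>tilt p u\<close> instead of
  \<open>p\<close>: the tilt is at most \<open>- p u\<close> at \<open>- u\<close>, which forces a
  linear functional below it to reach \<open>p u\<close> at \<open>u\<close>.\<close>

theorem hahn_banach_dominated:
  fixes p :: "'v::real_vector \<Rightarrow> real"
  assumes p: "sublinear p"
  obtains f where "linear f" "\<And>v. f v \<le> p v" "f u = p u"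
proof -
  obtain f where f: "sublinear f" "f \<le> tilt p u"
      "\<And>q'. sublinear q' \<Longrightarrow> q' \<le> f \<Longrightarrow> q' = f"
    using ex_minimal_sublinear[OF sublinear_tilt[OF p, of u]] by blast
  have lin: "linear f" using minimal_sublinear_linear f(1,3) by blast
  have le: "f v \<le> p v" for v
    using le_funD[OF f(2), of v] tilt_le[OF p, of 0 u v] by simp
  have "f (- u) \<le> - p u"
    using le_funD[OF f(2), of "- u"] tilt_le[OF p, of 1 u "- u"] by (simp add: sublinear_zero[OF p])
  then have "p u \<le> f u" using linear_neg[OF lin, of u] by simp
  with le[of u] have "f u = p u" by simp
  with lin le show thesis by (rule that)
qed

section \<open>Jointly convex pseudometrics\<close>

text \<open>Distinct points may be at distance \<open>0\<close>: in the application, different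
  mixtures can share a barycenter.\<close>

locale convex_pseudometric =
  fixes M :: "'v::real_vector set" and D :: "'v \<Rightarrow> 'v \<Rightarrow> real"
  assumes convex: "convex M"
    and nonneg: "\<And>a b. 0 \<le> D a b"
    and self: "\<And>a. a \<in> M \<Longrightarrow> D a a = 0"
    and sym: "\<And>a b. D a b = D b a"
    and triangle: "\<And>a b c. a \<in> M \<Longrightarrow> b \<in> M \<Longrightarrow> c \<in> M \<Longrightarrow> D a c \<le> D a b + D b c"
    and jointly_convex: "\<And>a b a' b' t. a \<in> M \<Longrightarrow> b \<in> M \<Longrightarrow> a' \<in> M \<Longrightarrow> b' \<in> M \<Longrightarrow>
      0 \<le> t \<Longrightarrow> t \<le> 1 \<Longrightarrow>
      D (t *\<^sub>R a + (1 - t) *\<^sub>R a') (t *\<^sub>R b + (1 - t) *\<^sub>R b') \<le> t * D a b + (1 - t) * D a' b'"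
begin

lemma mix: "a \<in> M \<Longrightarrow> b \<in> M \<Longrightarrow> 0 \<le> t \<Longrightarrow> t \<le> 1 \<Longrightarrow> t *\<^sub>R a + (1 - t) *\<^sub>R b \<in> M"
  using convexD[OF convex, of a b t "1 - t"] by simp

text \<open>Joint convexity bounds the distances from the intermediate point to both ends from
  above; their bounds add up to \<open>D a b\<close>, so the triangle inequality makes them
  equalities.\<close>

lemma segment:
  assumes ab: "a \<in> M" "b \<in> M" and s: "0 \<le> s" "s \<le> 1"
  shows "D a (s *\<^sub>R b + (1 - s) *\<^sub>R a) = s * D a b"
proof -
  let ?c = "s *\<^sub>R b + (1 - s) *\<^sub>R a"
  have eq: "s *\<^sub>R x + (1 - s) *\<^sub>R x = x" for x :: 'v by (simp add: algebra_simps)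
  have "D a ?c \<le> s * D a b"
    using jointly_convex[OF ab(1,2,1,1) s] self[OF ab(1)] by (simp add: eq)
  moreover have "D ?c b \<le> (1 - s) * D a b"
    using jointly_convex[OF ab(2,2,1,2) s] self[OF ab(2)] by (simp add: eq)
  moreover have "D a b \<le> D a ?c + D ?c b"
    by (intro triangle mix ab s)
  ultimately show ?thesis by (simp add: algebra_simps)
qed

text \<open>
  The inequality \<open>\<le>\<close> is joint convexity. For \<open>\<ge>\<close>, let \<open>a' = t a + (1 - t) r\<close>, \<open>b' = t b + (1 - t) r\<close>
  and contract the pair \<open>a', b'\<close> towards \<open>a\<close> by a small factor \<open>l\<close>. This moves \<open>a'\<close> to a point \<open>u\<close>
  close to \<open>a\<close>, and \<open>b'\<close> to a point on the segment from \<open>u\<close> to a point close to \<open>b\<close>, along which \<open>D\<close>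
  is known by \<open>segment\<close>. Then let \<open>l\<close> tend to \<open>0\<close>.
\<close>

lemma cancel:
  assumes M: "a \<in> M" "b \<in> M" "r \<in> M" and t: "0 < t" "t \<le> 1"
  shows "D (t *\<^sub>R a + (1 - t) *\<^sub>R r) (t *\<^sub>R b + (1 - t) *\<^sub>R r) = t * D a b"
proof (rule antisym)
  let ?a = "t *\<^sub>R a + (1 - t) *\<^sub>R r" and ?b = "t *\<^sub>R b + (1 - t) *\<^sub>R r"
  let ?K = "D a r + D b r"
  show "D ?a ?b \<le> t * D a b"
    using jointly_convex[of a b r r t] M t self[of r] by simp
  have *: "t * D a b \<le> D ?a ?b + l * ?K" if l: "0 < l" "l < 1" for l
  proof -
    \<comment> \<open>\<open>e\<close> is the weight of \<open>r\<close> in both contracted points,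
      and \<open>s\<close> solves \<open>s * (1 - e) = l * t\<close>, which matches the weight of
      \<open>b\<close> in the contraction of \<open>?b\<close>.\<close>
    define e where "e = l * (1 - t)"
    define s where "s = l * t / (1 - e)"
    have e: "0 \<le> e" "e < 1" "e \<le> l"
    proof -
      show "0 \<le> e" "e \<le> l" unfolding e_def using l t by (auto simp: mult_le_cancel_left1)
      then show "e < 1" using l by simp
    qed
    have se: "s * (1 - e) = l * t" unfolding s_def using e by simp
    have lt: "l * t \<le> 1 - e" "0 < l * t" unfolding e_def using l t by (auto simp: algebra_simps)
    then have s: "0 \<le> s" "s \<le> 1" unfolding s_def using e by auto
    define u where "u = (1 - e) *\<^sub>R a + e *\<^sub>R r"
    define w where "w = (1 - e) *\<^sub>R b + e *\<^sub>R r"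
    have uw: "u \<in> M" "w \<in> M"
      using mix[of a r "1 - e"] mix[of b r "1 - e"] M e by (simp_all add: u_def w_def)
    have ab: "?a \<in> M" "?b \<in> M" using M t by (auto intro!: mix)
    have "l *\<^sub>R ?a + (1 - l) *\<^sub>R a = u"
      by (simp add: u_def e_def algebra_simps)
    moreover have "l *\<^sub>R ?b + (1 - l) *\<^sub>R a = s *\<^sub>R w + (1 - s) *\<^sub>R u"
    proof -
      have "s *\<^sub>R w + (1 - s) *\<^sub>R u = (s * (1 - e)) *\<^sub>R b + ((1 - e) - s * (1 - e)) *\<^sub>R a + e *\<^sub>R r"
        by (simp add: u_def w_def algebra_simps)
      then show ?thesis unfolding se by (simp add: e_def algebra_simps)
    qed
    ultimately have "D u (s *\<^sub>R w + (1 - s) *\<^sub>R u) \<le> l * D ?a ?b"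
      using jointly_convex[of ?a ?b a a l] ab M l self[of a] by simp
    then have "s * D u w \<le> l * D ?a ?b"
      using segment[OF uw s] by simp
    \<comment> \<open>The factor \<open>1 - e\<close> turns \<open>s\<close> into
      \<open>l * t\<close>, after which \<open>l\<close> cancels.\<close>
    then have "(1 - e) * (s * D u w) \<le> (1 - e) * (l * D ?a ?b)"
      using e by (intro mult_left_mono) auto
    then have "l * (t * D u w) \<le> l * ((1 - e) * D ?a ?b)"
      using se by (metis (no_types, opaque_lifting) mult.assoc mult.commute)
    then have "t * D u w \<le> (1 - e) * D ?a ?b" using l by simp
    also have "\<dots> \<le> D ?a ?b" using e nonneg by (simp add: mult_left_le_one_le)
    finally have D: "t * D u w \<le> D ?a ?b" .
    \<comment> \<open>Returning from \<open>u\<close>, \<open>w\<close> to \<open>a\<close>,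
      \<open>b\<close> costs \<open>e * ?K\<close> in total, and \<open>e \<le> l\<close>.\<close>
    have "D a u = e * D a r" "D b w = e * D b r"
      using segment[of a r e] segment[of b r e] M e by (simp_all add: u_def w_def add.commute)
    moreover have "D a b \<le> D a u + D u w + D b w"
      using triangle[of a u b] triangle[of u w b] uw M sym[of w b] by simp
    ultimately have "D a b \<le> D u w + e * ?K" by (simp add: algebra_simps)
    then have "t * D a b \<le> t * (D u w + e * ?K)" using t by simp
    also have "\<dots> = t * D u w + t * (e * ?K)" by (simp add: algebra_simps)
    also have "\<dots> \<le> D ?a ?b + 1 * (l * ?K)"
      using D t e nonneg[of a r] nonneg[of b r] l by (intro add_mono mult_mono) auto
    finally show ?thesis by simp
  qed
  show "t * D a b \<le> D ?a ?b"
  proof (rule tendsto_lowerbound)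
    show "((\<lambda>l. D ?a ?b + l * ?K) \<longlongrightarrow> D ?a ?b) (at_right 0)"
      by (auto intro!: tendsto_eq_intros)
    show "\<forall>\<^sub>F l in at_right 0. t * D a b \<le> D ?a ?b + l * ?K"
      by (rule eventually_mono[OF eventually_at_right_real[of 0 1]]) (simp_all add: *)
  qed simp
qed

section \<open>The sublinear functional induced on differences\<close>

text \<open>The cone generated by the differences of points of \<open>M\<close>; for nonempty
  \<open>M\<close> it is their linear span.\<close>

definition diffs :: "'v set" where
  "diffs = {s *\<^sub>R (a - b) | s a b. 0 \<le> s \<and> a \<in> M \<and> b \<in> M}"

text \<open>On \<open>diffs\<close> the choice is among equal values, by
  \<open>scaled_dist_unique\<close>; elsewhere the value is unspecified.\<close>

definition diff_norm :: "'v \<Rightarrow> real" where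
  "diff_norm v = (SOME r. \<exists>s a b. 0 \<le> s \<and> a \<in> M \<and> b \<in> M \<and> v = s *\<^sub>R (a - b) \<and> r = s * D a b)"

text \<open>With \<open>t = s / (s + s')\<close>, the equation says that mixing \<open>a\<close>
  with \<open>b'\<close> gives the same point as mixing \<open>b\<close> with \<open>a'\<close>.
  Applying \<open>cancel\<close> with the common point \<open>b'\<close> and then with
  \<open>b\<close> evaluates one distance in two ways.\<close>

lemma scaled_dist_unique:
  assumes M: "a \<in> M" "b \<in> M" "a' \<in> M" "b' \<in> M" and s: "0 \<le> s" "0 \<le> s'"
    and eq: "s *\<^sub>R (a - b) = s' *\<^sub>R (a' - b')"
  shows "s * D a b = s' * D a' b'"
proof (cases "s = 0 \<or> s' = 0")
  case True
  then have "s *\<^sub>R (a - b) = 0" "s' *\<^sub>R (a' - b') = 0" using eq by auto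
  then have "s = 0 \<or> a = b" "s' = 0 \<or> a' = b'" by auto
  then show ?thesis using self M by auto
next
  case False
  then have pos: "0 < s" "0 < s'" using s by auto
  define t where "t = s / (s + s')"
  have t: "0 < t" "t < 1" and t': "1 - t = s' / (s + s')"
    unfolding t_def using pos by (auto simp: field_simps)
  have "t *\<^sub>R (a - b) = (1 / (s + s')) *\<^sub>R (s *\<^sub>R (a - b))" by (simp add: t_def)
  also have "\<dots> = (1 - t) *\<^sub>R (a' - b')" unfolding eq t' by simp
  finally have mixed: "t *\<^sub>R a + (1 - t) *\<^sub>R b' = (1 - t) *\<^sub>R a' + t *\<^sub>R b"
    by (simp add: algebra_simps)
  have "t * D a b = D (t *\<^sub>R a + (1 - t) *\<^sub>R b') (t *\<^sub>R b + (1 - t) *\<^sub>R b')"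
    using cancel[of a b b' t] M t by simp
  also have "\<dots> = D ((1 - t) *\<^sub>R a' + t *\<^sub>R b) ((1 - t) *\<^sub>R b' + t *\<^sub>R b)"
    unfolding mixed by (simp add: add.commute)
  also have "\<dots> = (1 - t) * D a' b'"
    using cancel[of a' b' b "1 - t"] M t by simp
  finally have "s * D a b / (s + s') = s' * D a' b' / (s + s')"
    unfolding t' by (simp add: t_def)
  then show ?thesis using pos by simp
qed

lemma diff_norm_eq:
  assumes "a \<in> M" "b \<in> M" "0 \<le> s"
  shows "diff_norm (s *\<^sub>R (a - b)) = s * D a b"
  unfolding diff_norm_def
proof (rule some_equality)
  fix r assume "\<exists>s' a' b'. 0 \<le> s' \<and> a' \<in> M \<and> b' \<in> M \<and> s *\<^sub>R (a - b) = s' *\<^sub>R (a' - b') \<and> r = s' * D a' b'"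
  then show "r = s * D a b" using scaled_dist_unique assms by metis
qed (use assms in blast)

text \<open>The sum is \<open>s + s'\<close> times the difference of two convex combinations with
  weights proportional to \<open>s\<close> and \<open>s'\<close>, so subadditivity is joint
  convexity.\<close>

lemma diffs_add:
  assumes "u \<in> diffs" "v \<in> diffs"
  shows "u + v \<in> diffs \<and> diff_norm (u + v) \<le> diff_norm u + diff_norm v"
proof -
  obtain s a b where u: "u = s *\<^sub>R (a - b)" "0 \<le> s" "a \<in> M" "b \<in> M"
    using assms(1) by (auto simp: diffs_def)
  obtain s' a' b' where v: "v = s' *\<^sub>R (a' - b')" "0 \<le> s'" "a' \<in> M" "b' \<in> M"
    using assms(2) by (auto simp: diffs_def)
  show ?thesis
  proof (cases "s + s' = 0")
    case True
    then have "s = 0" "s' = 0" using u(2) v(2) by auto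
    then have "u = 0" "v = 0" using u v by auto
    moreover have "diff_norm 0 = 0" using diff_norm_eq[of a b 0] u by simp
    ultimately show ?thesis using assms by simp
  next
    case False
    define t where "t = s / (s + s')"
    have t: "0 \<le> t" "t \<le> 1" and ss: "(s + s') * t = s" "(s + s') * (1 - t) = s'"
      unfolding t_def using u(2) v(2) False by (auto simp: field_simps)
    let ?a = "t *\<^sub>R a + (1 - t) *\<^sub>R a'" and ?b = "t *\<^sub>R b + (1 - t) *\<^sub>R b'"
    have ab: "?a \<in> M" "?b \<in> M" using u v t by (auto intro: mix)
    have "(s + s') *\<^sub>R (?a - ?b) = ((s + s') * t) *\<^sub>R (a - b) + ((s + s') * (1 - t)) *\<^sub>R (a' - b')"
      by (simp only: scaleR_scaleR[symmetric] scaleR_add_right[symmetric]) (simp add: algebra_simps)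
    then have eq: "u + v = (s + s') *\<^sub>R (?a - ?b)"
      unfolding ss u v by simp
    then have "diff_norm (u + v) = (s + s') * D ?a ?b"
      using diff_norm_eq[OF ab, of "s + s'"] u v by simp
    also have "\<dots> \<le> (s + s') * (t * D a b + (1 - t) * D a' b')"
      using u v t by (intro mult_left_mono jointly_convex) auto
    also have "\<dots> = s * D a b + s' * D a' b'"
      by (metis (no_types) ss distrib_left mult.assoc)
    also have "\<dots> = diff_norm u + diff_norm v"
      using diff_norm_eq u v by simp
    finally have "diff_norm (u + v) \<le> diff_norm u + diff_norm v" .
    moreover have "u + v \<in> diffs"
      unfolding diffs_def using eq ab u(2) v(2) by (metis (mono_tags, lifting) add_nonneg_nonneg mem_Collect_eq)
    ultimately show ?thesis by simp
  qed
qed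

lemma diffs_scale:
  assumes "v \<in> diffs" "0 \<le> c"
  shows "c *\<^sub>R v \<in> diffs \<and> diff_norm (c *\<^sub>R v) = c * diff_norm v"
proof -
  obtain s a b where v: "v = s *\<^sub>R (a - b)" "0 \<le> s" "a \<in> M" "b \<in> M"
    using assms(1) by (auto simp: diffs_def)
  have "c *\<^sub>R v = (c * s) *\<^sub>R (a - b)" "0 \<le> c * s" using v assms by simp_all
  then show ?thesis using v diff_norm_eq[of a b s] diff_norm_eq[of a b "c * s"]
    unfolding diffs_def by (auto intro: exI[of _ "c * s"])
qed

lemma diffs_uminus: "v \<in> diffs \<Longrightarrow> - v \<in> diffs"
proof -
  assume "v \<in> diffs"
  then obtain s a b where "v = s *\<^sub>R (a - b)" "0 \<le> s" "a \<in> M" "b \<in> M"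
    by (auto simp: diffs_def)
  moreover from this have "- v = s *\<^sub>R (b - a)" by (simp add: algebra_simps)
  ultimately show ?thesis unfolding diffs_def by blast
qed

lemma subspace_diffs:
  assumes "M \<noteq> {}"
  shows "subspace diffs"
proof (rule subspaceI)
  obtain a where "a \<in> M" using assms by blast
  moreover have "0 = 0 *\<^sub>R (a - a)" by simp
  ultimately show "0 \<in> diffs" unfolding diffs_def by blast
  show "u + v \<in> diffs" if "u \<in> diffs" "v \<in> diffs" for u v
    using diffs_add that by blast
  show "c *\<^sub>R v \<in> diffs" if "v \<in> diffs" for c v
    using diffs_scale[of v c] diffs_scale[OF diffs_uminus[OF that], of "- c"] that
    by (cases "0 \<le> c") auto
qed

text \<open>Hahn-Banach for \<open>diff_norm\<close> at the vector \<open>a - b\<close>, using that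
  \<open>diff_norm (x - y) = D x y\<close> on \<open>M\<close>.\<close>

lemma ex_norming_functional:
  assumes ab: "a \<in> M" "b \<in> M"
  obtains f where "linear f" "\<And>x y. x \<in> M \<Longrightarrow> y \<in> M \<Longrightarrow> f x - f y \<le> D x y" "f a - f b = D a b"
proof -
  have "subspace diffs" using ab by (intro subspace_diffs) auto
  \<comment> \<open>\<open>diff_norm\<close> is controlled only on \<open>diffs\<close>; composing
    it with a linear projection onto this subspace gives a sublinear functional on the whole
    space.\<close>
  then obtain \<pi> where \<pi>: "range \<pi> \<subseteq> diffs" "linear \<pi>" "\<And>v. v \<in> diffs \<Longrightarrow> \<pi> v = v"
    using linear_exists_left_inverse_on[OF linear_id, of diffs] by auto
  have in_diffs: "\<pi> v \<in> diffs" for v using \<pi>(1) by blast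
  have "sublinear (diff_norm \<circ> \<pi>)"
    using diffs_add[OF in_diffs in_diffs] diffs_scale[OF in_diffs]
    by (simp add: sublinear_def linear_add[OF \<pi>(2)] linear_cmul[OF \<pi>(2)])
  then obtain f where f: "linear f" "\<And>v. f v \<le> (diff_norm \<circ> \<pi>) v" "f (a - b) = (diff_norm \<circ> \<pi>) (a - b)"
    using hahn_banach_dominated[of "diff_norm \<circ> \<pi>" "a - b"] by blast
  have "(diff_norm \<circ> \<pi>) (x - y) = D x y" if xy: "x \<in> M" "y \<in> M" for x y
  proof -
    have "x - y = 1 *\<^sub>R (x - y)" by simp
    then have "x - y \<in> diffs" using xy unfolding diffs_def by (metis (mono_tags, lifting) mem_Collect_eq zero_le_one)
    with diff_norm_eq[OF xy, of 1] \<pi>(3) show ?thesis by simp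
  qed
  with f ab show thesis
    by (intro that[of f]) (simp_all flip: linear_diff[OF f(1)], metis)
qed

end

section \<open>Barycenters\<close>

lemma sum_fun_apply: "(\<Sum>i\<in>A. f i) x = (\<Sum>i\<in>A. f i x)" for f :: "'i \<Rightarrow> 'a \<Rightarrow> 'b::comm_monoid_add"
  by (induction A rule: infinite_finite_induct) simp_all

definition point_mass :: "'a \<Rightarrow> 'a \<Rightarrow> real" where
  "point_mass x = indicator {x}"

definition mixture :: "nat \<Rightarrow> (nat \<Rightarrow> real) \<Rightarrow> (nat \<Rightarrow> 'a) \<Rightarrow> 'a \<Rightarrow> real" where
  "mixture n w x = (\<Sum>i=1..n. w i *\<^sub>R point_mass (x i))"

lemma mixture_apply: "mixture n w x y = (\<Sum>i=1..n. w i * indicator {x i} y)"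
  by (simp add: mixture_def point_mass_def sum_fun_apply scaleR_fun_def)

text \<open>Together with \<open>mixture_support\<close>, this recovers the weights and the set of
  points from a mixture of distinct points with positive weights.\<close>

lemma mixture_apply_inj:
  assumes "inj_on x {1..n}" "i \<in> {1..n}"
  shows "mixture n w x (x i) = w i"
proof -
  have "mixture n w x (x i) = (\<Sum>j=1..n. if j = i then w j else 0)"
    unfolding mixture_apply
    by (rule sum.cong) (simp_all add: indicator_def inj_on_eq_iff[OF assms(1) assms(2)])
  then show ?thesis using assms(2) by simp
qed

lemma mixture_support:
  assumes "inj_on x {1..n}" "\<forall>i\<in>{1..n}. 0 < w i"
  shows "{y. mixture n w x y \<noteq> 0} = x ` {1..n}"
proof
  show "x ` {1..n} \<subseteq> {y. mixture n w x y \<noteq> 0}"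
    using assms mixture_apply_inj[OF assms(1), of _ w] by force
  show "{y. mixture n w x y \<noteq> 0} \<subseteq> x ` {1..n}"
  proof (rule subsetI, rule ccontr)
    fix y assume "y \<in> {y. mixture n w x y \<noteq> 0}" "y \<notin> x ` {1..n}"
    then show False
      unfolding mixture_apply by (auto simp: indicator_def image_iff intro!: sum.neutral)
  qed
qed

lemma mixture_permutes:
  assumes "\<sigma> permutes {1..n}"
  shows "mixture n (w \<circ> \<sigma>) (x \<circ> \<sigma>) = mixture n w x"
  unfolding mixture_def using sum.permute[OF assms, of "\<lambda>i. w i *\<^sub>R point_mass (x i)"] by (simp add: o_def)

lemma Prob_permutes:
  assumes "\<sigma> permutes {1..n}" "w \<in> Prob n"
  shows "w \<circ> \<sigma> \<in> Prob n"
proof -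
  have "(\<Sum>i=1..n. (w \<circ> \<sigma>) i) = 1"
    using sum.permute[OF assms(1), of w] assms(2) by (simp add: Prob_def)
  then show ?thesis
    using assms permutes_in_image[OF assms(1)] permutes_not_in[OF assms(1)]
    by (auto simp: Prob_def extensional_def)
qed

lemma PiE_permutes:
  assumes "\<sigma> permutes S" "x \<in> S \<rightarrow>\<^sub>E X"
  shows "x \<circ> \<sigma> \<in> S \<rightarrow>\<^sub>E X"
  using assms permutes_in_image[OF assms(1)] permutes_not_in[OF assms(1)]
  by (auto simp: PiE_def Pi_def extensional_def)

lemma sum_split_first_two:
  fixes h :: "nat \<Rightarrow> 'b::comm_monoid_add"
  assumes "2 \<le> n"
  shows "(\<Sum>j=1..n. h j) = h 1 + h 2 + (\<Sum>j=3..n. h j)"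
proof -
  have "{1..n} = insert 1 (insert 2 {3..n})" using assms by auto
  then show ?thesis by (simp add: add.assoc)
qed

text \<open>The left side has the shape that axiom \<open>merge\<close> produces: the indices
  \<open>2..n - 1\<close> stand for the original entries \<open>3..n\<close>.\<close>

lemma sum_merge_first_two:
  fixes h :: "nat \<Rightarrow> 'b::comm_monoid_add"
  assumes "2 \<le> n"
  shows "(\<Sum>j=1..n-1. if j = 1 then a else h (j + 1)) = a + (\<Sum>j=3..n. h j)"
proof -
  have "(\<Sum>j=2..n-1. if j = 1 then a else h (j + 1)) = (\<Sum>j=3..n. h j)"
    by (rule sum.reindex_bij_witness[of _ "\<lambda>j. j - 1" "\<lambda>j. j + 1"]) auto
  moreover have "{1..n - 1} = insert 1 {2..n - 1}" using assms by auto
  ultimately show ?thesis by simp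
qed

text \<open>Brings two arbitrary entries to the positions where axiom \<open>merge\<close>
  acts.\<close>

lemma permutes_1_2:
  assumes "i \<in> {1..n}" "j \<in> {1..n}" "i \<noteq> j"
  obtains \<sigma> :: "nat \<Rightarrow> nat" where "\<sigma> permutes {1..n}" "\<sigma> 1 = i" "\<sigma> 2 = j"
proof
  \<comment> \<open>The preimage of \<open>j\<close> under the outer transposition. It differs from
    \<open>1\<close> because \<open>i \<noteq> j\<close>, so the inner transposition fixes
    \<open>1\<close>.\<close>
  let ?j = "Transposition.transpose 1 i j"
  have n: "2 \<le> n" using assms by auto
  show "Transposition.transpose 1 i \<circ> Transposition.transpose 2 ?j permutes {1..n}"
    using assms n by (intro permutes_compose permutes_swap_id) (auto simp: Transposition.transpose_def)
  show "(Transposition.transpose 1 i \<circ> Transposition.transpose 2 ?j) 1 = i" "(Transposition.transpose 1 i \<circ> Transposition.transpose 2 ?j) 2 = j"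
    using assms by (auto simp: Transposition.transpose_def)
qed

section \<open>Dependence of \<gamma> on the mixture alone\<close>

context convex_like_structure
begin

lemma \<gamma>_closed:
  assumes "n \<ge> 1" "w \<in> Prob n" "x \<in> {1..n} \<rightarrow>\<^sub>E X"
  shows "\<gamma> n w x \<in> X"
  using continuous_map_image_subset_topspace[OF continuous[OF assms(1,2)]] assms(3)
  by (auto simp: topspace_product_topology)

text \<open>Every term of the bound in \<open>dist_le\<close> vanishes, so entries of weight zero
  can be replaced freely.\<close>

lemma \<gamma>_cong_null:
  assumes n: "n \<ge> 1" "w \<in> Prob n" and x: "x \<in> {1..n} \<rightarrow>\<^sub>E X" and y: "y \<in> {1..n} \<rightarrow>\<^sub>E X"
    and eq: "\<And>i. i \<in> {1..n} \<Longrightarrow> w i = 0 \<or> x i = y i"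
  shows "\<gamma> n w x = \<gamma> n w y"
proof -
  have "w i * d (x i) (y i) = 0" if i: "i \<in> {1..n}" for i
    using eq[OF i] PiE_mem[OF x i] PiE_mem[OF y i] by auto
  then have "(\<Sum>i=1..n. w i * d (x i) (y i)) = 0" by (intro sum.neutral) auto
  then have "d (\<gamma> n w x) (\<gamma> n w y) \<le> 0" using dist_le[OF n x y] by simp
  then show ?thesis
    using \<gamma>_closed[OF n x] \<gamma>_closed[OF n y] nonneg by (metis antisym zero)
qed

text \<open>An entry of weight zero is first overwritten by \<open>x j\<close>, so that in both
  cases two equal entries are moved to the front and merged.\<close>

lemma \<gamma>_merge:
  assumes n: "n \<ge> 1" "w \<in> Prob n" and x: "x \<in> {1..n} \<rightarrow>\<^sub>E X"
    and ij: "i \<in> {1..n}" "j \<in> {1..n}" "i \<noteq> j" "w i = 0 \<or> x i = x j"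
  obtains w' x' where "w' \<in> Prob (n - 1)" "x' \<in> {1..n - 1} \<rightarrow>\<^sub>E X"
    "mixture (n - 1) w' x' = mixture n w x" "\<gamma> (n - 1) w' x' = \<gamma> n w x"
proof -
  have n2: "2 \<le> n" using ij by auto
  define y where "y = x(i := x j)"
  have y: "y \<in> {1..n} \<rightarrow>\<^sub>E X"
    using x ij unfolding y_def by (auto simp: PiE_def Pi_def extensional_def)
  have y_mix: "mixture n w y = mixture n w x"
    unfolding mixture_def y_def using ij(4) by (intro sum.cong) auto
  have y_eq: "\<gamma> n w y = \<gamma> n w x"
    using ij(4) by (intro \<gamma>_cong_null n x y) (auto simp: y_def)
  obtain \<sigma> where \<sigma>: "\<sigma> permutes {1..n}" "\<sigma> 1 = i" "\<sigma> 2 = j"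
    using permutes_1_2[OF ij(1-3)] .
  define v z where "v = w \<circ> \<sigma>" and "z = y \<circ> \<sigma>"
  have v: "v \<in> Prob n" and z: "z \<in> {1..n} \<rightarrow>\<^sub>E X"
    unfolding v_def z_def by (rule Prob_permutes[OF \<sigma>(1) n(2)], rule PiE_permutes[OF \<sigma>(1) y])
  have z12: "z 1 = z 2" using \<sigma> ij(3) by (simp add: z_def y_def)
  define w' where "w' = (\<lambda>j\<in>{1..n - 1}. if j = 1 then v 1 + v 2 else v (j + 1))"
  define x' where "x' = (\<lambda>j\<in>{1..n - 1}. if j = 1 then z 1 else z (j + 1))"
  show thesis
  proof
    have "(\<Sum>j=1..n-1. w' j) = (\<Sum>j=1..n-1. if j = 1 then v 1 + v 2 else v (j + 1))"
      by (intro sum.cong) (auto simp: w'_def)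
    also have "\<dots> = 1"
      unfolding sum_merge_first_two[OF n2] using v sum_split_first_two[OF n2, of v]
      by (simp add: Prob_def)
    moreover have "0 \<le> w' j" if "j \<in> {1..n - 1}" for j
      using that v n2 by (auto simp: w'_def Prob_def)
    ultimately show "w' \<in> Prob (n - 1)" by (simp add: Prob_def w'_def)
    show "x' \<in> {1..n - 1} \<rightarrow>\<^sub>E X"
      unfolding x'_def using z n2 by (auto intro!: PiE_mem[OF z])
    have "mixture (n - 1) w' x' = (\<Sum>j=1..n-1. if j = 1 then (v 1 + v 2) *\<^sub>R point_mass (z 1)
        else v (j + 1) *\<^sub>R point_mass (z (j + 1)))"
      unfolding mixture_def by (intro sum.cong) (auto simp: w'_def x'_def)
    also have "\<dots> = mixture n v z"
      unfolding mixture_def sum_split_first_two[OF n2]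
        sum_merge_first_two[OF n2, where h = "\<lambda>j. v j *\<^sub>R point_mass (z j)"]
      by (simp only: scaleR_add_left z12)
    also have "\<dots> = mixture n w x"
      unfolding v_def z_def mixture_permutes[OF \<sigma>(1)] by (rule y_mix)
    finally show "mixture (n - 1) w' x' = mixture n w x" .
    have "\<gamma> (n - 1) w' x' = \<gamma> n v z"
      unfolding w'_def x'_def using merge[OF n2 v z z12] by simp
    also have "\<dots> = \<gamma> n w x"
      unfolding v_def z_def using perm[OF n \<sigma>(1) y] y_eq by simp
    finally show "\<gamma> (n - 1) w' x' = \<gamma> n w x" .
  qed
qed

text \<open>As long as some weight is zero or some point is repeated, \<open>\<gamma>_merge\<close>
  shortens the tuple without changing its mixture or its image under \<gamma>.\<close>

lemma \<gamma>_reduce: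
  assumes "n \<ge> 1" "w \<in> Prob n" "x \<in> {1..n} \<rightarrow>\<^sub>E X"
  shows "\<exists>m v y. m \<ge> 1 \<and> v \<in> Prob m \<and> y \<in> {1..m} \<rightarrow>\<^sub>E X \<and> mixture m v y = mixture n w x \<and>
    \<gamma> m v y = \<gamma> n w x \<and> inj_on y {1..m} \<and> (\<forall>i\<in>{1..m}. 0 < v i)"
  using assms
proof (induction n arbitrary: w x rule: less_induct)
  case (less n)
  show ?case
  proof (cases "inj_on x {1..n} \<and> (\<forall>i\<in>{1..n}. 0 < w i)")
    case True
    show ?thesis
      using True less.prems by (intro exI[of _ n] exI[of _ w] exI[of _ x] conjI) simp_all
  next
    case False
    have "\<exists>i j. i \<in> {1..n} \<and> j \<in> {1..n} \<and> i \<noteq> j \<and> (w i = 0 \<or> x i = x j)"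
    proof (cases "inj_on x {1..n}")
      case True
      with False obtain i where i: "i \<in> {1..n}" "\<not> 0 < w i" by blast
      then have w: "w i = 0" using less.prems(2) by (force simp: Prob_def)
      \<comment> \<open>Merging needs a second index; it exists because the weights sum to
        \<open>1\<close> while \<open>w i = 0\<close>.\<close>
      have "\<exists>j\<in>{1..n}. j \<noteq> i"
      proof (rule ccontr)
        assume "\<not> (\<exists>j\<in>{1..n}. j \<noteq> i)"
        with w have "(\<Sum>j=1..n. w j) = 0" by (intro sum.neutral) auto
        with less.prems(2) show False by (simp add: Prob_def)
      qed
      with i w show ?thesis by blast
    next
      case False
      then show ?thesis unfolding inj_on_def by blast
    qed
    then obtain i j where ij: "i \<in> {1..n}" "j \<in> {1..n}" "i \<noteq> j" "w i = 0 \<or> x i = x j"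
      by blast
    obtain w' x' where *: "w' \<in> Prob (n - 1)" "x' \<in> {1..n - 1} \<rightarrow>\<^sub>E X"
        "mixture (n - 1) w' x' = mixture n w x" "\<gamma> (n - 1) w' x' = \<gamma> n w x"
      using \<gamma>_merge[OF less.prems ij] .
    have "n - 1 < n" "1 \<le> n - 1" using ij by auto
    from less.IH[OF this *(1,2)] show ?thesis unfolding *(3,4) .
  qed
qed

text \<open>Equal supports give the same set of points, so the tuples differ by a permutation;
  evaluating the mixture at each point shows that the same permutation matches the weights, and
  axiom \<open>perm\<close> applies.\<close>

lemma \<gamma>_eq_of_reduced:
  assumes n: "n \<ge> 1" "w \<in> Prob n" "x \<in> {1..n} \<rightarrow>\<^sub>E X"
    and m: "v \<in> Prob m" "y \<in> {1..m} \<rightarrow>\<^sub>E X"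
    and x: "inj_on x {1..n}" "\<forall>i\<in>{1..n}. 0 < w i"
    and y: "inj_on y {1..m}" "\<forall>i\<in>{1..m}. 0 < v i"
    and eq: "mixture n w x = mixture m v y"
  shows "\<gamma> n w x = \<gamma> m v y"
proof -
  have img: "x ` {1..n} = y ` {1..m}"
    using mixture_support[OF x] mixture_support[OF y] eq by simp
  then have nm: "n = m" using card_image[OF x(1)] card_image[OF y(1)] by simp
  define \<sigma> where "\<sigma> i = (if i \<in> {1..n} then inv_into {1..n} x (y i) else i)" for i
  have "bij_betw (inv_into {1..n} x \<circ> y) {1..n} {1..n}"
    using y(1) img nm by (intro bij_betw_trans[OF _ bij_betw_inv_into[OF inj_on_imp_bij_betw[OF x(1)]]])
      (auto simp: bij_betw_def)
  then have "bij_betw \<sigma> {1..n} {1..n}"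
    by (rule bij_betw_cong[THEN iffD1, rotated]) (simp add: \<sigma>_def)
  then have \<sigma>: "\<sigma> permutes {1..n}" by (rule bij_imp_permutes) (simp only: \<sigma>_def if_False)
  have x\<sigma>: "x (\<sigma> i) = y i" and w\<sigma>: "w (\<sigma> i) = v i" if i: "i \<in> {1..n}" for i
  proof -
    have "y i \<in> x ` {1..n}" using i img nm by auto
    then show *: "x (\<sigma> i) = y i" using i by (simp add: \<sigma>_def f_inv_into_f)
    have "\<sigma> i \<in> {1..n}" using permutes_in_image[OF \<sigma>] i by simp
    then have "w (\<sigma> i) = mixture n w x (x (\<sigma> i))" by (simp add: mixture_apply_inj[OF x(1)])
    also have "\<dots> = v i" unfolding * eq using i nm by (simp add: mixture_apply_inj[OF y(1)])
    finally show "w (\<sigma> i) = v i" .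
  qed
  have "x \<circ> \<sigma> = y"
  proof (rule PiE_ext[OF PiE_permutes[OF \<sigma> n(3)]])
    show "y \<in> {1..n} \<rightarrow>\<^sub>E X" using m nm by simp
  qed (simp add: x\<sigma>)
  moreover have "w \<circ> \<sigma> = v"
  proof (rule extensionalityI[of _ "{1..n}"])
    show "w \<circ> \<sigma> \<in> extensional {1..n}" "v \<in> extensional {1..n}"
      using Prob_permutes[OF \<sigma> n(2)] m nm by (auto simp: Prob_def)
  qed (simp add: w\<sigma>)
  ultimately show ?thesis using perm[OF n(1,2) \<sigma> n(3)] nm by simp
qed

lemma \<gamma>_eq_of_mixture_eq:
  assumes n: "n \<ge> 1" "w \<in> Prob n" "x \<in> {1..n} \<rightarrow>\<^sub>E X"
    and m: "m \<ge> 1" "v \<in> Prob m" "y \<in> {1..m} \<rightarrow>\<^sub>E X"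
    and eq: "mixture n w x = mixture m v y"
  shows "\<gamma> n w x = \<gamma> m v y"
proof -
  obtain n' w' x' where x': "n' \<ge> 1" "w' \<in> Prob n'" "x' \<in> {1..n'} \<rightarrow>\<^sub>E X"
      "mixture n' w' x' = mixture n w x" "\<gamma> n' w' x' = \<gamma> n w x"
      "inj_on x' {1..n'}" "\<forall>i\<in>{1..n'}. 0 < w' i"
    using \<gamma>_reduce[OF n] by (elim exE conjE) (rule that)
  obtain m' v' y' where y': "m' \<ge> 1" "v' \<in> Prob m'" "y' \<in> {1..m'} \<rightarrow>\<^sub>E X"
      "mixture m' v' y' = mixture m v y" "\<gamma> m' v' y' = \<gamma> m v y"
      "inj_on y' {1..m'}" "\<forall>i\<in>{1..m'}. 0 < v' i"
    using \<gamma>_reduce[OF m] by (elim exE conjE) (rule that)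
  have "\<gamma> n' w' x' = \<gamma> m' v' y'"
    using \<gamma>_eq_of_reduced[OF x'(1-3) y'(2,3) x'(6,7) y'(6,7)] x'(4) y'(4) eq by simp
  then show ?thesis using x'(5) y'(5) by simp
qed

end

section \<open>The barycenter map on the convex hull of the point masses\<close>

context convex_like_structure
begin

definition mixtures :: "('a \<Rightarrow> real) set" where
  "mixtures = convex hull (point_mass ` X)"

text \<open>For \<open>v\<close> in \<open>mixtures\<close>, exactly one \<open>z\<close> qualifies,
  by \<open>\<gamma>_eq_of_mixture_eq\<close>.\<close>

definition barycenter :: "('a \<Rightarrow> real) \<Rightarrow> 'a" where
  "barycenter v = (SOME z. \<exists>n w x. n \<ge> 1 \<and> w \<in> Prob n \<and> x \<in> {1..n} \<rightarrow>\<^sub>E X \<and>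
    mixture n w x = v \<and> z = \<gamma> n w x)"

lemma mixtures_cases:
  assumes "v \<in> mixtures"
  obtains n w x where "n \<ge> 1" "w \<in> Prob n" "x \<in> {1..n} \<rightarrow>\<^sub>E X" "v = mixture n w x"
proof -
  obtain n :: nat and w p where p: "\<forall>i\<in>{1..n}. 0 \<le> w i \<and> p i \<in> point_mass ` X"
      "sum w {1..n} = 1" "(\<Sum>i=1..n. w i *\<^sub>R p i) = v"
    using assms unfolding mixtures_def convex_hull_indexed mem_Collect_eq
    by (elim exE conjE) (rule that)
  have "\<exists>x. \<forall>i\<in>{1..n}. x i \<in> X \<and> p i = point_mass (x i)"
    by (rule bchoice) (use p(1) in blast)
  then obtain x where x: "\<And>i. i \<in> {1..n} \<Longrightarrow> x i \<in> X \<and> p i = point_mass (x i)" by blast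
  show thesis
  proof
    show "1 \<le> n" using p(2) by (cases n) auto
    show "restrict w {1..n} \<in> Prob n" using p by (simp add: Prob_def)
    show "restrict x {1..n} \<in> {1..n} \<rightarrow>\<^sub>E X" using x by auto
    show "v = mixture n (restrict w {1..n}) (restrict x {1..n})"
      unfolding mixture_def p(3)[symmetric] using x by (intro sum.cong) auto
  qed
qed

lemma mixture_in_mixtures:
  assumes "w \<in> Prob n" "x \<in> {1..n} \<rightarrow>\<^sub>E X"
  shows "mixture n w x \<in> mixtures"
  unfolding mixtures_def mixture_def
proof (rule convex_sum)
  show "point_mass (x i) \<in> convex hull (point_mass ` X)" if "i \<in> {1..n}" for i
    using PiE_mem[OF assms(2) that] by (intro hull_inc imageI)
qed (use assms(1) in \<open>auto simp: Prob_def convex_convex_hull\<close>)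

lemma point_mass_in_mixtures: "x \<in> X \<Longrightarrow> point_mass x \<in> mixtures"
  unfolding mixtures_def by (intro hull_inc imageI)

lemma barycenter_mixture:
  assumes "n \<ge> 1" "w \<in> Prob n" "x \<in> {1..n} \<rightarrow>\<^sub>E X"
  shows "barycenter (mixture n w x) = \<gamma> n w x"
  unfolding barycenter_def
proof (rule some_equality)
  show "\<exists>m v y. m \<ge> 1 \<and> v \<in> Prob m \<and> y \<in> {1..m} \<rightarrow>\<^sub>E X \<and>
      mixture m v y = mixture n w x \<and> \<gamma> n w x = \<gamma> m v y"
    using assms by (intro exI[of _ n] exI[of _ w] exI[of _ x] conjI) simp_all
next
  fix z assume "\<exists>m v y. m \<ge> 1 \<and> v \<in> Prob m \<and> y \<in> {1..m} \<rightarrow>\<^sub>E X \<and>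
      mixture m v y = mixture n w x \<and> z = \<gamma> m v y"
  then show "z = \<gamma> n w x"
    by (elim exE conjE) (simp only:, rule \<gamma>_eq_of_mixture_eq, (rule assms | assumption)+)
qed

lemma barycenter_in: "v \<in> mixtures \<Longrightarrow> barycenter v \<in> X"
  by (erule mixtures_cases) (simp add: barycenter_mixture \<gamma>_closed)

lemma barycenter_point_mass:
  assumes "x \<in> X"
  shows "barycenter (point_mass x) = x"
proof -
  let ?w = "\<lambda>i\<in>{1..1::nat}. 1::real" and ?x = "\<lambda>i\<in>{1..1::nat}. x"
  have w: "?w \<in> Prob 1" and x: "?x \<in> {1..1} \<rightarrow>\<^sub>E X" using assms by (auto simp: Prob_def)
  have "mixture 1 ?w ?x = point_mass x" by (simp add: mixture_def)
  then have "barycenter (point_mass x) = \<gamma> 1 ?w ?x"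
    using barycenter_mixture[OF _ w x] by simp
  also have "\<dots> = ?x 1" by (rule dirac[OF _ w x]) auto
  finally show ?thesis by simp
qed

text \<open>The binary weights and pairs have the shape in which axiom \<open>compose\<close> is stated.\<close>

abbreviation pair_weights :: "real \<Rightarrow> nat \<Rightarrow> real" where
  "pair_weights t \<equiv> \<lambda>k\<in>{1..2}. if k = 1 then t else 1 - t"

abbreviation pair_points :: "'a \<Rightarrow> 'a \<Rightarrow> nat \<Rightarrow> 'a" where
  "pair_points x y \<equiv> \<lambda>k\<in>{1..2}. if k = 1 then x else y"

lemma atLeastAtMost_1_2: "{Suc 0..2} = {Suc 0, 2}"
  by auto

lemma pair_weights_apply: "pair_weights t 1 = t" "pair_weights t 2 = 1 - t"
  by simp_all

lemma pair_weights_Prob: "0 \<le> t \<Longrightarrow> t \<le> 1 \<Longrightarrow> pair_weights t \<in> Prob 2"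
  by (simp add: Prob_def atLeastAtMost_1_2)

lemma pair_points_PiE: "x \<in> X \<Longrightarrow> y \<in> X \<Longrightarrow> pair_points x y \<in> {1..2} \<rightarrow>\<^sub>E X"
  by auto

lemma sum_append:
  fixes f g :: "nat \<Rightarrow> 'b::comm_monoid_add"
  shows "(\<Sum>k=1..n + m. if k \<le> n then f k else g (k - n)) = (\<Sum>k=1..n. f k) + (\<Sum>k=1..m. g k)"
proof -
  have "(\<Sum>k=1..n + m. if k \<le> n then f k else g (k - n)) =
      (\<Sum>k=1..n. if k \<le> n then f k else g (k - n)) +
      (\<Sum>k=n + 1..n + m. if k \<le> n then f k else g (k - n))"
    by (rule sum.ub_add_nat) simp
  moreover have "(\<Sum>k=n + 1..n + m. if k \<le> n then f k else g (k - n)) = (\<Sum>k=1..m. g k)"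
    by (rule sum.reindex_bij_witness[of _ "\<lambda>k. k + n" "\<lambda>k. k - n"]) auto
  ultimately show ?thesis by simp
qed

text \<open>Concatenating presentations of \<open>a\<close> and \<open>b\<close>, with weights
  scaled by \<open>t\<close> and \<open>1 - t\<close>, presents the combination; axiom
  \<open>compose\<close> rewrites its image under \<gamma> as the binary one.\<close>

lemma barycenter_convex_combination:
  assumes a: "a \<in> mixtures" and b: "b \<in> mixtures" and t: "0 \<le> t" "t \<le> 1"
  shows "barycenter (t *\<^sub>R a + (1 - t) *\<^sub>R b) =
    \<gamma> 2 (pair_weights t) (pair_points (barycenter a) (barycenter b))"
proof -
  obtain n w x where x: "n \<ge> 1" "w \<in> Prob n" "x \<in> {1..n} \<rightarrow>\<^sub>E X" "a = mixture n w x"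
    using a by (rule mixtures_cases)
  obtain m v y where y: "m \<ge> 1" "v \<in> Prob m" "y \<in> {1..m} \<rightarrow>\<^sub>E X" "b = mixture m v y"
    using b by (rule mixtures_cases)
  define u where "u = (\<lambda>k\<in>{1..n + m}. if k \<le> n then t * w k else (1 - t) * v (k - n))"
  define z where "z = (\<lambda>k\<in>{1..n + m}. if k \<le> n then x k else y (k - n))"
  have "(\<Sum>k=1..n + m. u k) = (\<Sum>k=1..n + m. if k \<le> n then t * w k else (1 - t) * v (k - n))"
    by (intro sum.cong) (simp_all add: u_def)
  also have "\<dots> = t * (\<Sum>k=1..n. w k) + (1 - t) * (\<Sum>k=1..m. v k)"
    unfolding sum_append[where f = "\<lambda>k. t * w k" and g = "\<lambda>k. (1 - t) * v k"]
    by (simp add: sum_distrib_left)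
  also have "\<dots> = 1" using x(2) y(2) by (simp add: Prob_def)
  finally have "(\<Sum>k=1..n + m. u k) = 1" .
  moreover have "0 \<le> u k" if "k \<in> {1..n + m}" for k
  proof -
    have "\<And>k. k \<in> {1..n} \<Longrightarrow> 0 \<le> w k" "\<And>k. k \<in> {1..m} \<Longrightarrow> 0 \<le> v k"
      using x(2) y(2) by (simp_all add: Prob_def)
    moreover have "k - n \<in> {1..m}" if "\<not> k \<le> n" using that \<open>k \<in> {1..n + m}\<close> by auto
    ultimately show ?thesis using that t unfolding u_def by simp
  qed
  ultimately have u: "u \<in> Prob (n + m)" by (simp add: Prob_def u_def)
  have z: "z \<in> {1..n + m} \<rightarrow>\<^sub>E X"
    unfolding z_def by (auto intro!: PiE_mem[OF x(3)] PiE_mem[OF y(3)]) arith+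
  have "mixture (n + m) u z = (\<Sum>k=1..n + m. if k \<le> n then t *\<^sub>R w k *\<^sub>R point_mass (x k)
      else (1 - t) *\<^sub>R v (k - n) *\<^sub>R point_mass (y (k - n)))"
    unfolding mixture_def by (intro sum.cong) (auto simp: u_def z_def)
  also have "\<dots> = t *\<^sub>R a + (1 - t) *\<^sub>R b"
    unfolding sum_append[where f = "\<lambda>k. t *\<^sub>R w k *\<^sub>R point_mass (x k)"
        and g = "\<lambda>k. (1 - t) *\<^sub>R v k *\<^sub>R point_mass (y k)"]
    by (simp only: x(4) y(4) mixture_def scaleR_sum_right)
  finally have "barycenter (t *\<^sub>R a + (1 - t) *\<^sub>R b) = \<gamma> (n + m) u z"
    using barycenter_mixture[OF _ u z] x(1) by simp
  also have "\<dots> = \<gamma> 2 (pair_weights t) (pair_points (\<gamma> n w x) (\<gamma> m v y))"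
    using compose[OF x(1) y(1) pair_weights_Prob[OF t] x(2) y(2) x(3) y(3)]
    unfolding pair_weights_apply u_def z_def by (rule sym)
  finally show ?thesis
    unfolding x(4) y(4) barycenter_mixture[OF x(1-3)] barycenter_mixture[OF y(1-3)] .
qed

text \<open>Joint convexity is \<open>dist_le\<close> for pairs, once both combinations are written
  with binary \<gamma>.\<close>

lemma convex_pseudometric_mixtures:
  "convex_pseudometric mixtures (\<lambda>a b. d (barycenter a) (barycenter b))"
proof
  show "convex mixtures" unfolding mixtures_def by (rule convex_convex_hull)
next
  fix a b a' b' :: "'a \<Rightarrow> real" and t :: real
  assume M: "a \<in> mixtures" "b \<in> mixtures" "a' \<in> mixtures" "b' \<in> mixtures" and t: "0 \<le> t" "t \<le> 1"
  let ?x = "pair_points (barycenter a) (barycenter a')"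
    and ?y = "pair_points (barycenter b) (barycenter b')"
  have "d (barycenter (t *\<^sub>R a + (1 - t) *\<^sub>R a')) (barycenter (t *\<^sub>R b + (1 - t) *\<^sub>R b')) =
      d (\<gamma> 2 (pair_weights t) ?x) (\<gamma> 2 (pair_weights t) ?y)"
    by (simp only: barycenter_convex_combination M t)
  also have "\<dots> \<le> (\<Sum>i=1..2. pair_weights t i * d (?x i) (?y i))"
    by (intro dist_le pair_weights_Prob pair_points_PiE barycenter_in M t) simp
  also have "\<dots> = t * d (barycenter a) (barycenter b) + (1 - t) * d (barycenter a') (barycenter b')"
    by (simp add: atLeastAtMost_1_2)
  finally show "d (barycenter (t *\<^sub>R a + (1 - t) *\<^sub>R a')) (barycenter (t *\<^sub>R b + (1 - t) *\<^sub>R b')) \<le>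
      t * d (barycenter a) (barycenter b) + (1 - t) * d (barycenter a') (barycenter b')" .
qed (auto simp: barycenter_in commute intro: triangle)

section \<open>Affine functions with Lipschitz constant 1\<close>

definition affine_functions :: "('a \<Rightarrow> real) set" where
  "affine_functions = {h. (\<forall>x\<in>X. \<forall>y\<in>X. \<bar>h x - h y\<bar> \<le> d x y) \<and>
    (\<forall>n\<ge>1. \<forall>w\<in>Prob n. \<forall>x\<in>{1..n} \<rightarrow>\<^sub>E X. h (\<gamma> n w x) = (\<Sum>i=1..n. w i * h (x i)))}"

text \<open>A norming linear functional on mixtures, pulled back to \<open>X\<close> along
  \<open>point_mass\<close>.\<close>

lemma ex_norming_affine_function:
  assumes xy: "x \<in> X" "y \<in> X"
  obtains h where "h \<in> affine_functions" "h x - h y = d x y"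
proof -
  interpret convex_pseudometric mixtures "\<lambda>a b. d (barycenter a) (barycenter b)"
    by (rule convex_pseudometric_mixtures)
  obtain f where f: "linear f"
      "\<And>a b. a \<in> mixtures \<Longrightarrow> b \<in> mixtures \<Longrightarrow> f a - f b \<le> d (barycenter a) (barycenter b)"
      "f (point_mass x) - f (point_mass y) = d (barycenter (point_mass x)) (barycenter (point_mass y))"
    using ex_norming_functional[of "point_mass x" "point_mass y"] point_mass_in_mixtures xy by blast
  define h where "h z = f (point_mass z)" for z
  have "h u - h v \<le> d u v" if "u \<in> X" "v \<in> X" for u v
    unfolding h_def
    using f(2)[of "point_mass u" "point_mass v"] that
    by (simp add: point_mass_in_mixtures barycenter_point_mass)
  then have "\<bar>h u - h v\<bar> \<le> d u v" if "u \<in> X" "v \<in> X" for u v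
    using that commute[of u v] by (simp add: abs_le_iff) (metis minus_diff_eq)
  moreover have "h (\<gamma> n w z) = (\<Sum>i=1..n. w i * h (z i))"
    if n: "n \<ge> 1" "w \<in> Prob n" and z: "z \<in> {1..n} \<rightarrow>\<^sub>E X" for n w z
  proof -
    have g: "\<gamma> n w z \<in> X" by (rule \<gamma>_closed[OF n z])
    \<comment> \<open>Both arguments have the same barycenter, so the bound on \<open>f\<close>
      gives a difference of at most \<open>0\<close> in either order. This turns linearity of
      \<open>f\<close> into affinity of \<open>h\<close>.\<close>
    have "f (point_mass (\<gamma> n w z)) = f (mixture n w z)"
      using f(2)[of "point_mass (\<gamma> n w z)" "mixture n w z"]
        f(2)[of "mixture n w z" "point_mass (\<gamma> n w z)"] g
      by (simp add: point_mass_in_mixtures mixture_in_mixtures[OF n(2) z] barycenter_point_mass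
          barycenter_mixture[OF n z])
    also have "\<dots> = (\<Sum>i=1..n. w i * h (z i))"
      by (simp add: mixture_def linear_sum[OF f(1)] linear_cmul[OF f(1)] h_def)
    finally show ?thesis by (simp add: h_def)
  qed
  ultimately have "h \<in> affine_functions" unfolding affine_functions_def by blast
  moreover have "h x - h y = d x y"
    using f(3) xy by (simp add: h_def barycenter_point_mass)
  ultimately show thesis by (rule that)
qed

end

section \<open>Bounded functions and the embedding\<close>

definition bounded_functions :: "('b \<Rightarrow> real) set" where
  "bounded_functions = {F. bdd_above (range (\<lambda>h. \<bar>F h\<bar>))}"

text \<open>The value \<open>0\<close> on unbounded functions keeps nonnegativity and homogeneity
  true everywhere, as \<open>banach_on\<close> demands.\<close>

definition sup_norm :: "('b \<Rightarrow> real) \<Rightarrow> real" where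
  "sup_norm F = (if F \<in> bounded_functions then SUP h. \<bar>F h\<bar> else 0)"

lemma bounded_functionsI: "(\<And>h. \<bar>F h\<bar> \<le> c) \<Longrightarrow> F \<in> bounded_functions"
  unfolding bounded_functions_def by (auto intro!: bdd_aboveI2)

lemma sup_norm_upper: "F \<in> bounded_functions \<Longrightarrow> \<bar>F h\<bar> \<le> sup_norm F"
  unfolding sup_norm_def by (auto simp: bounded_functions_def intro: cSUP_upper)

lemma sup_norm_least: "(\<And>h. \<bar>F h\<bar> \<le> c) \<Longrightarrow> sup_norm F \<le> c"
  unfolding sup_norm_def using bounded_functionsI[of F c] by (auto intro: cSUP_least)

lemma sup_norm_nonneg: "0 \<le> sup_norm F"
  using sup_norm_upper[of F undefined] unfolding sup_norm_def
  by (cases "F \<in> bounded_functions") (auto intro: order_trans[OF abs_ge_zero])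

lemma bounded_functions_add:
  assumes "F \<in> bounded_functions" "G \<in> bounded_functions"
  shows "\<bar>(F + G) h\<bar> \<le> sup_norm F + sup_norm G"
  using sup_norm_upper[OF assms(1), of h] sup_norm_upper[OF assms(2), of h] by simp

lemma bounded_functions_scaleR: "F \<in> bounded_functions \<Longrightarrow> c *\<^sub>R F \<in> bounded_functions"
  by (rule bounded_functionsI[where c = "\<bar>c\<bar> * sup_norm F"])
    (simp add: scaleR_fun_def abs_mult mult_left_mono sup_norm_upper)

lemma subspace_bounded_functions: "subspace bounded_functions"
proof (rule subspaceI)
  show "0 \<in> bounded_functions" by (rule bounded_functionsI[where c = 0]) simp
  show "F + G \<in> bounded_functions" if "F \<in> bounded_functions" "G \<in> bounded_functions"
    for F G :: "'b \<Rightarrow> real"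
    using bounded_functions_add[OF that] by (rule bounded_functionsI)
qed (rule bounded_functions_scaleR)

text \<open>For bounded \<open>F\<close> and \<open>c \<noteq> 0\<close>, the inequality
  \<open>le\<close> is used for \<open>c\<close> and for \<open>inverse c\<close>. An unbounded
  function stays unbounded under such a factor, so both sides are \<open>0\<close>.\<close>

lemma sup_norm_scaleR: "sup_norm (c *\<^sub>R F) = \<bar>c\<bar> * sup_norm F" for F :: "'b \<Rightarrow> real"
proof -
  have le: "sup_norm (c *\<^sub>R F) \<le> \<bar>c\<bar> * sup_norm F" if "F \<in> bounded_functions" for c and F :: "'b \<Rightarrow> real"
    using that by (intro sup_norm_least)
      (simp add: scaleR_fun_def abs_mult mult_left_mono sup_norm_upper)
  have zero: "sup_norm (0 :: 'b \<Rightarrow> real) = 0"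
    using sup_norm_least[of "0 :: 'b \<Rightarrow> real" 0] sup_norm_nonneg[of "0 :: 'b \<Rightarrow> real"] by simp
  show ?thesis
  proof (cases "c = 0")
    case False
    then have F: "F = inverse c *\<^sub>R (c *\<^sub>R F)" by simp
    show ?thesis
    proof (cases "F \<in> bounded_functions")
      case True
      have "sup_norm F \<le> \<bar>inverse c\<bar> * sup_norm (c *\<^sub>R F)"
        using le[OF bounded_functions_scaleR[OF True, of c], of "inverse c"] F by simp
      with le[OF True, of c] False show ?thesis by (simp add: field_simps)
    next
      case False
      then have "c *\<^sub>R F \<notin> bounded_functions"
        using bounded_functions_scaleR[of "c *\<^sub>R F" "inverse c"] F by auto
      with False show ?thesis by (simp add: sup_norm_def)
    qed
  qed (simp add: zero)
qed

lemma Metric_space_sup_norm: "Metric_space (bounded_functions :: ('b \<Rightarrow> real) set) (norm_dist sup_norm)"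
proof
  fix F G H :: "'b \<Rightarrow> real"
  show "0 \<le> sup_norm (F - G)" by (rule sup_norm_nonneg)
  show "sup_norm (F - G) = sup_norm (G - F)"
    using sup_norm_scaleR[of "-1" "F - G"] by simp
  assume F: "F \<in> bounded_functions" and G: "G \<in> bounded_functions"
  have FG: "F - G \<in> bounded_functions" by (rule subspace_diff[OF subspace_bounded_functions F G])
  show "sup_norm (F - G) = 0 \<longleftrightarrow> F = G"
  proof
    assume "sup_norm (F - G) = 0"
    then show "F = G" using sup_norm_upper[OF FG] by (auto simp: fun_eq_iff)
  next
    assume "F = G"
    then show "sup_norm (F - G) = 0" using sup_norm_scaleR[of 0 F] by simp
  qed
  assume H: "H \<in> bounded_functions"
  have GH: "G - H \<in> bounded_functions" by (rule subspace_diff[OF subspace_bounded_functions G H])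
  show "sup_norm (F - H) \<le> sup_norm (F - G) + sup_norm (G - H)"
    using bounded_functions_add[OF FG GH] by (intro sup_norm_least) simp
qed

text \<open>Cauchy sequences for the supremum norm are uniformly Cauchy. Their uniform limit is
  bounded, being within \<open>1\<close> of some member of the sequence.\<close>

lemma mcomplete_sup_norm:
  "Metric_space.mcomplete (bounded_functions :: ('b \<Rightarrow> real) set) (norm_dist sup_norm)"
proof -
  interpret Metric_space "bounded_functions :: ('b \<Rightarrow> real) set" "norm_dist sup_norm"
    by (rule Metric_space_sup_norm)
  show ?thesis
    unfolding mcomplete_def
  proof (intro allI impI)
    fix \<sigma> :: "nat \<Rightarrow> 'b \<Rightarrow> real" assume "MCauchy \<sigma>"
    then have \<sigma>: "\<sigma> n \<in> bounded_functions"
      and cauchy: "\<And>e. 0 < e \<Longrightarrow> \<exists>N. \<forall>n n'. N \<le> n \<longrightarrow> N \<le> n' \<longrightarrow> sup_norm (\<sigma> n - \<sigma> n') < e" for n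
      by (auto simp: MCauchy_def)
    have diff: "\<bar>\<sigma> n h - \<sigma> m h\<bar> \<le> sup_norm (\<sigma> n - \<sigma> m)" for n m h
      using sup_norm_upper[OF subspace_diff[OF subspace_bounded_functions \<sigma> \<sigma>], of n m h] by simp
    have "uniformly_Cauchy_on UNIV \<sigma>"
      unfolding uniformly_Cauchy_on_def dist_real_def
      using cauchy diff by (meson le_less_trans)
    then obtain F where "uniform_limit UNIV \<sigma> F sequentially"
      using Cauchy_uniformly_convergent uniformly_convergent_on_def by blast
    then have F: "\<exists>N. \<forall>n\<ge>N. \<forall>h. \<bar>\<sigma> n h - F h\<bar> < e" if "0 < e" for e
      using that by (auto simp: uniform_limit_iff eventually_sequentially dist_real_def)
    obtain N where N: "\<And>h. \<bar>\<sigma> N h - F h\<bar> < 1" using F[of 1] by auto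
    have "F \<in> bounded_functions"
    proof (rule bounded_functionsI)
      show "\<bar>F h\<bar> \<le> sup_norm (\<sigma> N) + 1" for h
        using sup_norm_upper[OF \<sigma>[of N], of h] N[of h] by linarith
    qed
    moreover have "\<exists>N. \<forall>n\<ge>N. sup_norm (\<sigma> n - F) < e" if e: "0 < e" for e
    proof -
      \<comment> \<open>Half of \<open>e\<close> is used because a strict pointwise bound passes to
        the supremum only as a weak one.\<close>
      obtain N where N: "\<And>n h. N \<le> n \<Longrightarrow> \<bar>\<sigma> n h - F h\<bar> < e / 2" using F[of "e / 2"] e by auto
      have "sup_norm (\<sigma> n - F) < e" if "N \<le> n" for n
      proof -
        have "sup_norm (\<sigma> n - F) \<le> e / 2"
          using N[OF that] by (intro sup_norm_least) (simp add: less_imp_le)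
        with e show ?thesis by linarith
      qed
      then show ?thesis by blast
    qed
    ultimately have "limitin mtopology \<sigma> F sequentially"
      unfolding limit_metric_sequentially using \<sigma> by simp
    then show "\<exists>F. limitin mtopology \<sigma> F sequentially" by (intro exI[of _ F])
  qed
qed

lemma banach_on_sup_norm: "banach_on (bounded_functions :: ('b \<Rightarrow> real) set) sup_norm"
  unfolding banach_on_def
proof (intro conjI allI ballI impI)
  fix F G :: "'b \<Rightarrow> real" assume F: "F \<in> bounded_functions"
  show "F = 0" if "sup_norm F = 0"
    using sup_norm_upper[OF F] that by (auto simp: fun_eq_iff)
  show "sup_norm (F + G) \<le> sup_norm F + sup_norm G" if "G \<in> bounded_functions"
    using bounded_functions_add[OF F that] by (rule sup_norm_least)
qed (rule subspace_bounded_functions sup_norm_nonneg sup_norm_scaleR mcomplete_sup_norm)+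

text \<open>A convergent sequence in the image is Cauchy and pulls back to a Cauchy sequence in
  \<open>X\<close>; by uniqueness of limits, the image of the limit there is the given
  limit.\<close>

lemma closedin_isometric_image:
  assumes M: "Metric_space X d" "Metric_space.mcomplete X d" and B: "Metric_space B e"
    and f: "f ` X \<subseteq> B" "\<And>x y. x \<in> X \<Longrightarrow> y \<in> X \<Longrightarrow> e (f x) (f y) = d x y"
  shows "closedin (Metric_space.mtopology B e) (f ` X)"
proof -
  interpret X: Metric_space X d by (rule M(1))
  interpret B: Metric_space B e by (rule B)
  show ?thesis
    unfolding B.metric_closedin_iff_sequentially_closed
  proof (intro conjI allI impI f(1))
    fix \<sigma> l assume "range \<sigma> \<subseteq> f ` X \<and> limitin B.mtopology \<sigma> l sequentially"
    then have \<sigma>: "range \<sigma> \<subseteq> f ` X" and lim: "limitin B.mtopology \<sigma> l sequentially" by auto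
    have "\<forall>n. \<exists>x. x \<in> X \<and> \<sigma> n = f x" using \<sigma> by blast
    then obtain x where x: "\<And>n. x n \<in> X" "\<And>n. \<sigma> n = f (x n)" by metis
    have "B.MCauchy \<sigma>" using \<sigma> f(1) lim by (intro B.convergent_imp_MCauchy) auto
    then have "X.MCauchy x"
      using x f(2) by (auto simp: B.MCauchy_def X.MCauchy_def)
    then obtain z where z: "limitin X.mtopology x z sequentially"
      using M(2) by (auto simp: X.mcomplete_def)
    then have "limitin B.mtopology \<sigma> (f z) sequentially"
      unfolding B.limit_metric_sequentially X.limit_metric_sequentially
      using x f by (simp add: image_subset_iff)
    then have "l = f z" by (intro B.limitin_metric_unique[OF lim]) simp_all
    then show "l \<in> f ` X" using z by (auto simp: X.limit_metric_sequentially)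
  qed
qed

section \<open>The embedding by evaluation\<close>

context convex_like_structure
begin

text \<open>\<open>X\<close> may be empty, and the value is then arbitrary; hence
  \<open>base_point_in\<close> assumes some point of \<open>X\<close>.\<close>

definition base_point :: 'a where
  "base_point = (SOME x. x \<in> X)"

definition evaluation :: "'a \<Rightarrow> ('a \<Rightarrow> real) \<Rightarrow> real" where
  "evaluation x h = (if h \<in> affine_functions then h x - h base_point else 0)"

lemma base_point_in: "x \<in> X \<Longrightarrow> base_point \<in> X"
  unfolding base_point_def by (rule someI)

lemma evaluation_bounded:
  assumes "x \<in> X"
  shows "evaluation x \<in> bounded_functions"
proof (rule bounded_functionsI)
  show "\<bar>evaluation x h\<bar> \<le> d x base_point" for h
    using assms base_point_in[OF assms] nonneg[of x base_point]
    by (auto simp: evaluation_def affine_functions_def)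
qed

text \<open>The upper bound is the Lipschitz condition on each \<open>h\<close>, with the base point
  terms cancelling; the lower bound is attained at a norming \<open>h\<close>.\<close>

lemma evaluation_isometric:
  assumes xy: "x \<in> X" "y \<in> X"
  shows "sup_norm (evaluation x - evaluation y) = d x y"
proof (rule antisym)
  show "sup_norm (evaluation x - evaluation y) \<le> d x y"
    using xy by (intro sup_norm_least) (auto simp: evaluation_def affine_functions_def)
  obtain h where h: "h \<in> affine_functions" "h x - h y = d x y"
    using ex_norming_affine_function[OF xy] .
  have "evaluation x - evaluation y \<in> bounded_functions"
    by (intro subspace_diff subspace_bounded_functions evaluation_bounded xy)
  from sup_norm_upper[OF this, of h] h show "d x y \<le> sup_norm (evaluation x - evaluation y)"
    by (simp add: evaluation_def)
qed

lemma evaluation_affine: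
  assumes n: "n \<ge> 1" "w \<in> Prob n" and x: "x \<in> {1..n} \<rightarrow>\<^sub>E X"
  shows "evaluation (\<gamma> n w x) = (\<Sum>i=1..n. w i *\<^sub>R evaluation (x i))"
proof
  fix h
  show "evaluation (\<gamma> n w x) h = (\<Sum>i=1..n. w i *\<^sub>R evaluation (x i)) h"
  proof (cases "h \<in> affine_functions")
    case True
    then have "h (\<gamma> n w x) = (\<Sum>i=1..n. w i * h (x i))"
      unfolding affine_functions_def using n x by blast
    \<comment> \<open>Total weight \<open>1\<close> makes the subtracted constant
      \<open>h base_point\<close> compatible with affine combinations.\<close>
    moreover have "(\<Sum>i=1..n. w i) = 1" using n by (simp add: Prob_def)
    ultimately show ?thesis
      using True by (simp add: sum_fun_apply scaleR_fun_def evaluation_def right_diff_distrib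
          sum_subtractf flip: sum_distrib_right)
  qed (simp add: sum_fun_apply scaleR_fun_def evaluation_def)
qed

lemma convex_evaluation_image: "convex (evaluation ` X)"
  unfolding convex_alt
proof (intro ballI allI impI)
  fix F G and t :: real assume "F \<in> evaluation ` X" "G \<in> evaluation ` X" and t: "0 \<le> t \<and> t \<le> 1"
  then obtain x y where xy: "x \<in> X" "F = evaluation x" "y \<in> X" "G = evaluation y" by blast
  \<comment> \<open>\<open>convex_alt\<close> puts the weight \<open>t\<close> on the second point,
    whereas the argument of \<open>pair_weights\<close> is the weight of the first.\<close>
  have w: "pair_weights (1 - t) \<in> Prob 2" by (rule pair_weights_Prob) (use t in auto)
  have p: "pair_points x y \<in> {1..2} \<rightarrow>\<^sub>E X" by (rule pair_points_PiE[OF xy(1,3)])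
  have "evaluation (\<gamma> 2 (pair_weights (1 - t)) (pair_points x y)) =
      (\<Sum>i=1..2. pair_weights (1 - t) i *\<^sub>R evaluation (pair_points x y i))"
    by (rule evaluation_affine[OF _ w p]) simp
  also have "\<dots> = (1 - t) *\<^sub>R F + t *\<^sub>R G"
    by (simp add: atLeastAtMost_1_2 xy)
  finally have "(1 - t) *\<^sub>R F + t *\<^sub>R G = evaluation (\<gamma> 2 (pair_weights (1 - t)) (pair_points x y))"
    by (rule sym)
  then show "(1 - t) *\<^sub>R F + t *\<^sub>R G \<in> evaluation ` X"
    by (simp only:) (intro imageI \<gamma>_closed w p, simp)
qed

end

theorem theorem9:
  fixes X :: "'a set" and d :: "'a \<Rightarrow> 'a \<Rightarrow> real"
    and \<gamma> :: "nat \<Rightarrow> (nat \<Rightarrow> real) \<Rightarrow> (nat \<Rightarrow> 'a) \<Rightarrow> 'a"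
  assumes "convex_like_structure X d \<gamma>"
  shows "\<exists>(B :: (('a \<Rightarrow> real) \<Rightarrow> real) set) (N :: (('a \<Rightarrow> real) \<Rightarrow> real) \<Rightarrow> real)
      (C :: (('a \<Rightarrow> real) \<Rightarrow> real) set) (\<phi> :: 'a \<Rightarrow> (('a \<Rightarrow> real) \<Rightarrow> real)).
    banach_on B N \<and>
    C \<subseteq> B \<and> closedin (Metric_space.mtopology B (norm_dist N)) C \<and> convex C \<and>
    bij_betw \<phi> X C \<and>
    (\<forall>x\<in>X. \<forall>y\<in>X. N (\<phi> x - \<phi> y) = d x y) \<and>
    (\<forall>n\<ge>1. \<forall>\<mu>\<in>Prob n. \<forall>x\<in>{1..n} \<rightarrow>\<^sub>E X.
      \<phi> (\<gamma> n \<mu> x) = (\<Sum>i=1..n. \<mu> i *\<^sub>R \<phi> (x i)))"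
proof -
  interpret convex_like_structure X d \<gamma> by (rule assms)
  have sub: "evaluation ` X \<subseteq> bounded_functions" using evaluation_bounded by blast
  have inj: "inj_on evaluation X"
  proof (rule inj_onI)
    fix x y assume xy: "x \<in> X" "y \<in> X" "evaluation x = evaluation y"
    then have "d x y = sup_norm (evaluation x - evaluation x)"
      using evaluation_isometric[OF xy(1,2)] by simp
    also have "\<dots> = 0" using evaluation_isometric[OF xy(1,1)] xy by simp
    finally show "x = y" using xy by simp
  qed
  show ?thesis
  proof (intro exI conjI ballI allI impI)
    show "banach_on bounded_functions sup_norm" by (rule banach_on_sup_norm)
    show "evaluation ` X \<subseteq> bounded_functions" by (rule sub)
    show "closedin (Metric_space.mtopology bounded_functions (norm_dist sup_norm)) (evaluation ` X)"
      by (rule closedin_isometric_image[where d = d and f = evaluation, OF Metric_space_axioms complete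
            Metric_space_sup_norm sub evaluation_isometric])
    show "convex (evaluation ` X)" by (rule convex_evaluation_image)
    show "bij_betw evaluation X (evaluation ` X)" by (rule inj_on_imp_bij_betw[OF inj])
  qed (rule evaluation_isometric evaluation_affine; assumption)+
qed

end
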